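(* Fix a real number $a\ge0$, and let $G=(V,E)$ be a finite simple graph satisfying $\operatorname{mad}(G[N(v)])\le a$ for every $v\in V$. Then, for every real $\lambda>0$, $$\log Z_G(\lambda)\ge\sum_{v\in V}\frac{\mathcal A\bigl(W((1+\lambda)^a d(v)\log(1+\lambda))\bigr)}{(1+\lambda)^a d(v)},$$ where the summand for $d(v)=0$ is interpreted by continuity as $\log(1+\lambda)$.
   Context: All graphs are finite and simple; $\log$ is the natural logarithm. $N(v)$ is the set of neighbors of $v$ and $d(v)=|N(v)|$. $Z_G(\lambda)=\sum_{I\in\mathcal I(G)}\lambda^{|I|}$, where $\mathcal I(G)$ is the set of independent sets of $G$ including $\emptyset$. $\operatorname{mad}(H)=\max_{H'\subseteq H}2|E(H')|/|V(H')|$ (maximum over subgraphs $H'$ with at least one vertex), with $\operatorname{mad}(H)=0$ if $H$ has no vertices. $\mathcal A(x)=x^2/2+x$. $W$ is the principal nonnegative branch of the Lambert function: for $z\ge0$, $W(z)\ge0$ and $W(z)e^{W(z)}=z$. *)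

theory Defs
  imports "HOL-Analysis.Analysis"
begin

definition simple_graph :: "'a set \<Rightarrow> 'a set set \<Rightarrow> bool" where
  "simple_graph V E \<longleftrightarrow> finite V \<and> E \<subseteq> {{u, v} | u v. u \<in> V \<and> v \<in> V \<and> u \<noteq> v}"

definition subgraph :: "'a set \<Rightarrow> 'a set set \<Rightarrow> 'a set \<Rightarrow> 'a set set \<Rightarrow> bool" where
  "subgraph V' E' V E \<longleftrightarrow> simple_graph V' E' \<and> V' \<subseteq> V \<and> E' \<subseteq> E"

definition induced_edges :: "'a set set \<Rightarrow> 'a set \<Rightarrow> 'a set set" where
  "induced_edges E S = {e \<in> E. e \<subseteq> S}"

definition neighbors :: "'a set \<Rightarrow> 'a set set \<Rightarrow> 'a \<Rightarrow> 'a set" where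
  "neighbors V E v = {u \<in> V. {u, v} \<in> E}"

definition vertex_degree :: "'a set \<Rightarrow> 'a set set \<Rightarrow> 'a \<Rightarrow> nat" where
  "vertex_degree V E v = card (neighbors V E v)"

definition independent_sets :: "'a set \<Rightarrow> 'a set set \<Rightarrow> 'a set set" where
  "independent_sets V E = {I. I \<subseteq> V \<and> (\<forall>u\<in>I. \<forall>v\<in>I. {u, v} \<notin> E)}"

definition indep_poly :: "'a set \<Rightarrow> 'a set set \<Rightarrow> real \<Rightarrow> real" where
  "indep_poly V E lam = (\<Sum>I\<in>independent_sets V E. lam ^ card I)"

definition mad :: "'a set \<Rightarrow> 'a set set \<Rightarrow> real" where
  "mad V E = (if V = {} then 0 else
     Max {2 * real (card E') / real (card V') | V' E'. subgraph V' E' V E \<and> V' \<noteq> {}})"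

text \<open>The maximum is over a finite nonempty set, so \<^const>\<open>Max\<close> is meaningful.\<close>

lemma mad_set_finite_nonempty:
  assumes "simple_graph V E" "V \<noteq> {}"
  defines "M \<equiv> {2 * real (card E') / real (card V') | V' E'. subgraph V' E' V E \<and> V' \<noteq> {}}"
  shows "finite M" "M \<noteq> {}"
proof -
  have fV: "finite V" and "E \<subseteq> Pow V"
    using assms(1) by (auto simp: simple_graph_def)
  then have "finite (Pow V \<times> Pow E)"
    by (meson finite_Pow_iff finite_SigmaI finite_subset)
  moreover have "M \<subseteq> (\<lambda>(V', E'). 2 * real (card E') / real (card V')) ` (Pow V \<times> Pow E)"
    by (auto simp: M_def subgraph_def)
  ultimately show "finite M"
    by (meson finite_imageI finite_subset)
  have "subgraph V E V E"
    using assms(1) by (simp add: subgraph_def)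
  then show "M \<noteq> {}"
    using assms(2) by (auto simp: M_def)
qed


text \<open>Principal branch of the Lambert function on the nonnegative reals;
  unspecified for negative arguments.\<close>

definition lambert_W :: "real \<Rightarrow> real" where
  "lambert_W z = (THE w. w \<ge> 0 \<and> w * exp w = z)"

lemma lambert_W:
  assumes "z \<ge> 0"
  shows "lambert_W z \<ge> 0" "lambert_W z * exp (lambert_W z) = z"
proof -
  have "\<exists>w\<ge>0. w \<le> z \<and> w * exp w = z"
  proof (rule IVT')
    show "z \<le> z * exp z"
      using assms mult_left_mono[of 1 "exp z" z] by simp
  qed (use assms in \<open>auto intro!: continuous_intros\<close>)
  then obtain w where w: "w \<ge> 0" "w * exp w = z" by blast
  have "x = y" if "x \<ge> 0" "y \<ge> 0" "x * exp x = y * exp y" for x y :: real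
  proof -
    have less: "s * exp s < t * exp t" if "0 \<le> s" "s < t" for s t :: real
      using that by (intro mult_strict_mono) auto
    show ?thesis
      using less[of x y] less[of y x] that by linarith
  qed
  then have "\<exists>!w. w \<ge> 0 \<and> w * exp w = z"
    using w by metis
  from theI'[OF this] show "lambert_W z \<ge> 0" "lambert_W z * exp (lambert_W z) = z"
    unfolding lambert_W_def by auto
qed

definition A_fun :: "real \<Rightarrow> real" where
  "A_fun x = x\<^sup>2 / 2 + x"

definition bound_term :: "real \<Rightarrow> real \<Rightarrow> real \<Rightarrow> real" where
  "bound_term a lam d = (if d = 0 then ln (1 + lam) else
     A_fun (lambert_W ((1 + lam) powr a * d * ln (1 + lam))) / ((1 + lam) powr a * d))"

text \<open>The value at \<open>d = 0\<close> is the one given by continuity.\<close>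

lemma bound_term_tendsto_0:
  assumes "lam > 0"
  shows "(bound_term a lam \<longlongrightarrow> bound_term a lam 0) (at_right 0)"
proof -
  define K where "K = (1 + lam) powr a"
  define L where "L = ln (1 + lam)"
  have K: "K > 0" and L: "L > 0"
    using assms by (auto simp: K_def L_def)
  define w where "w d = lambert_W (K * d * L)" for d
  have w: "w d \<ge> 0" "w d * exp (w d) = K * d * L" if "d > 0" for d
    using lambert_W[of "K * d * L"] that K L by (auto simp: w_def)
  have w_le: "w d \<le> K * d * L" if "d > 0" for d
    using w[OF that] mult_left_mono[of 1 "exp (w d)" "w d"] by simp
  have "((\<lambda>d. K * d * L) \<longlongrightarrow> K * 0 * L) (at_right 0)"
    by (intro tendsto_intros)
  then have w0: "(w \<longlongrightarrow> 0) (at_right 0)"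
    by (intro real_tendsto_sandwich[of "\<lambda>_. 0" w _ "\<lambda>d. K * d * L"])
      (auto simp: eventually_at_right_less intro!: eventually_at_rightI[of 0 1] w w_le)
  have eq: "bound_term a lam d = L * (w d / 2 + 1) * exp (- w d)" if "d > 0" for d
  proof -
    have "K * d = w d * exp (w d) / L"
      using w(2)[OF that] L by (simp add: field_simps)
    moreover have "w d \<noteq> 0"
      using w(2)[OF that] that K L by auto
    moreover have "A_fun W / (W * exp W / L) = L * (W / 2 + 1) * exp (- W)" if "W \<noteq> 0" for W
      using that L by (simp add: A_fun_def exp_minus field_simps power2_eq_square)
    ultimately have "A_fun (w d) / (K * d) = L * (w d / 2 + 1) * exp (- w d)"
      by simp
    then show ?thesis
      using that by (simp add: bound_term_def w_def K_def L_def)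
  qed
  have "((\<lambda>d. L * (w d / 2 + 1) * exp (- w d)) \<longlongrightarrow> L * (0 / 2 + 1) * exp (- 0)) (at_right 0)"
    by (intro tendsto_intros w0) auto
  moreover have "\<forall>\<^sub>F d in at_right 0. L * (w d / 2 + 1) * exp (- w d) = bound_term a lam d"
    using eq by (auto intro!: eventually_at_rightI[of 0 1])
  ultimately show ?thesis
    using Lim_transform_eventually by (fastforce simp: bound_term_def L_def)
qed

end

theory Submission
  imports Defs
begin

text \<open>
  Give each vertex its own fugacity \<open>exp (s\<^sub>v) - 1\<close>, and let \<open>Z\<close> be the resulting weighted
  independence polynomial. Draw an independent set at random with probability proportional to its
  weight. Then \<open>\<partial> ln Z / \<partial> s\<^sub>v\<close> is the probability \<open>p\<^sub>v = Z (V - N v) / Z V\<close> that \<open>v\<close> is uncovered,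
  that is, has no neighbor in the random set. Write \<open>L = ln (1 + \<lambda>)\<close> and
  \<open>K = exp (a L) = (1 + \<lambda>) powr a\<close>.

  The hypothesis on \<open>mad\<close> enters through one local inequality. Fix the random set outside \<open>N v\<close>
  and let \<open>F\<close> be the set of neighbors of \<open>v\<close> that remain available. Then \<open>v\<close> is uncovered with
  conditional probability \<open>1 / Z F\<close>, while sparsity of \<open>F\<close> gives
  \<open>ln (Z F) \<le> K * (\<Sum>u\<in>F. s\<^sub>u p\<^sub>u(F))\<close>, where \<open>p\<^sub>u(F)\<close> is the conditional probability that \<open>u\<close> is
  uncovered (\<open>Z_ln_Z_le\<close>). Linearising \<open>1 / Z F = exp (- ln (Z F))\<close> at an arbitrary point \<open>b\<close> and
  averaging over \<open>F\<close> yields, for \<open>0 \<le> s \<le> L\<close>,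
  \<open>p\<^sub>v \<ge> exp (- b) * (1 + b - K * (\<Sum>u\<in>N v. s\<^sub>u p\<^sub>u))\<close> (\<open>uncovered_weight_ge\<close>).

  Now start from \<open>s = 0\<close>, where \<open>ln Z = 0\<close>, and integrate along the path
  \<open>s\<^sub>v(t) = t B\<^sub>v exp (t K D\<^sub>v)\<close> with \<open>D\<^sub>v = (\<Sum>u\<in>N v. B\<^sub>u)\<close>. The path is chosen so that, when the
  local inequalities with \<open>b = t K D\<^sub>v\<close> are added with weights \<open>B\<^sub>v exp b\<close>, all unknown probabilities
  recombine into \<open>d/dt ln Z\<close> exactly. What remains is an explicit lower bound for the derivative,
  and integration gives \<open>ln Z \<ge> (\<Sum>v. B\<^sub>v) + K/2 * (\<Sum>v. B\<^sub>v D\<^sub>v)\<close> (\<open>ln_Z_ge_path_gain\<close>).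

  The path must end at \<open>s = L\<close>, that is \<open>B\<^sub>v exp (K D\<^sub>v) = L\<close>. This is the critical point equation
  of the functional \<open>(\<Sum>v. B\<^sub>v ln (B\<^sub>v / L) - B\<^sub>v) + K/2 * (\<Sum>v. B\<^sub>v D\<^sub>v)\<close>, whose value at a critical
  point is the negative of the bound just obtained. So take \<open>B\<close> to be a global minimiser and
  compare it with the vector \<open>c\<close> defined by \<open>c\<^sub>v exp (K d(v) c\<^sub>v) = L\<close>. By \<open>2 c\<^sub>u c\<^sub>v \<le> c\<^sub>u\<^sup>2 + c\<^sub>v\<^sup>2\<close>
  on every edge, the functional at \<open>c\<close> is at most \<open>- (\<Sum>v. c\<^sub>v + K d(v) c\<^sub>v\<^sup>2 / 2)\<close>
  (\<open>exists_uniform_path_end\<close>). Solving for \<open>c\<^sub>v\<close> with the Lambert function turns these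
  summands into the ones of the theorem (\<open>bound_term_closed_form\<close>).
\<close>

section \<open>Graphs and neighborhoods\<close>

locale finite_graph =
  fixes V :: "'a set" and E :: "'a set set"
  assumes simple: "simple_graph V E"
begin

abbreviation N :: "'a \<Rightarrow> 'a set" where "N \<equiv> neighbors V E"

lemma finite_V: "finite V"
  using simple by (simp add: simple_graph_def)

lemma neighbors_subset: "N v \<subseteq> V"
  by (auto simp: neighbors_def)

lemma finite_neighbors: "finite (N v)"
  using neighbors_subset finite_V by (rule finite_subset)

lemma neighbors_sym: "u \<in> N v \<longleftrightarrow> v \<in> N u"
  using simple by (auto simp: neighbors_def simple_graph_def insert_commute doubleton_eq_iff)

lemma not_own_neighbor: "v \<notin> N v"
  using simple by (auto simp: neighbors_def simple_graph_def doubleton_eq_iff)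

lemma independent_sets_iff:
  assumes "X \<subseteq> V"
  shows "I \<in> independent_sets X E \<longleftrightarrow> I \<subseteq> X \<and> (\<forall>u\<in>I. \<forall>v\<in>I. u \<notin> N v)"
  using assms by (auto simp: independent_sets_def neighbors_def)

lemma finite_independent_sets: "X \<subseteq> V \<Longrightarrow> finite (independent_sets X E)"
  by (rule finite_subset[of _ "Pow V"]) (auto simp: independent_sets_def finite_V)

lemma finite_independent_set: "X \<subseteq> V \<Longrightarrow> I \<in> independent_sets X E \<Longrightarrow> finite I"
  using finite_V by (auto simp: independent_sets_def intro: finite_subset)

lemma diff_right_commute: "A - B - C = A - C - B" for A B C :: "'a set"
  by blast

lemma sum_neighbors_swap:
  "(\<Sum>v\<in>V. \<Sum>u\<in>N v. f v u) = (\<Sum>u\<in>V. \<Sum>v\<in>N u. f v u)"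
proof -
  have eq: "{u \<in> V. u \<in> N v} = N v" for v
    using neighbors_subset by auto
  have eq': "{v \<in> V. u \<in> N v} = N u" for u
    using neighbors_subset neighbors_sym by auto
  show ?thesis
    using sum.swap_restrict[of V V f "\<lambda>v u. u \<in> N v"] finite_V unfolding eq eq' by simp
qed

lemma double_sum_neighbors: "(\<Sum>u\<in>V. g u * (\<Sum>w\<in>N u. f w)) = (\<Sum>u\<in>V. f u * (\<Sum>w\<in>N u. g w))"
  for f g :: "'a \<Rightarrow> real"
  using sum_neighbors_swap[of "\<lambda>v u. g v * f u"]
  by (simp add: sum_distrib_left mult.commute)


section \<open>The weighted independence polynomial\<close>

definition Z :: "('a \<Rightarrow> real) \<Rightarrow> 'a set \<Rightarrow> real" where
  "Z w X = (\<Sum>I\<in>independent_sets X E. prod w I)"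

lemma Z_empty [simp]: "Z w {} = 1"
proof -
  have "independent_sets {} E = {{}}"
    by (auto simp: independent_sets_def)
  then show ?thesis by (simp add: Z_def)
qed

text \<open>
  Deletion and contraction at \<open>v\<close>: an independent set either avoids \<open>v\<close>, or it is \<open>v\<close> together
  with an independent set that avoids \<open>N v\<close>.
\<close>

lemma Z_insert:
  assumes "insert v X \<subseteq> V" "v \<notin> X"
  shows "Z w (insert v X) = Z w X + w v * Z w (X - N v)"
proof -
  have X: "X \<subseteq> V" "X - N v \<subseteq> V" using assms by auto
  have "independent_sets (insert v X) E = independent_sets X E \<union> insert v ` independent_sets (X - N v) E"
    (is "?A = ?B \<union> insert v ` ?C")
  proof (intro equalityI subsetI)
    fix I assume I: "I \<in> ?A"
    show "I \<in> ?B \<union> insert v ` ?C"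
    proof (cases "v \<in> I")
      case True
      have "I - {v} \<in> ?C"
        using I True unfolding independent_sets_iff[OF assms(1)] independent_sets_iff[OF X(2)] by blast
      moreover have "I = insert v (I - {v})" using True by blast
      ultimately show ?thesis by blast
    next
      case False
      then show ?thesis
        using I unfolding independent_sets_iff[OF assms(1)] Un_iff independent_sets_iff[OF X(1)] by blast
    qed
  next
    fix I assume "I \<in> ?B \<union> insert v ` ?C"
    then show "I \<in> ?A"
    proof
      assume "I \<in> ?B"
      then show ?thesis
        unfolding independent_sets_iff[OF assms(1)] independent_sets_iff[OF X(1)] by blast
    next
      assume "I \<in> insert v ` ?C"
      then obtain J where J: "I = insert v J" "J \<in> ?C" by blast
      then have "J \<subseteq> X - N v" "\<forall>u\<in>J. \<forall>v\<in>J. u \<notin> N v"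
        unfolding independent_sets_iff[OF X(2)] by auto
      moreover from this have "\<forall>u\<in>J. u \<notin> N v \<and> v \<notin> N u"
        using neighbors_sym by blast
      ultimately show ?thesis
        unfolding independent_sets_iff[OF assms(1)] J(1)
        using not_own_neighbor[of v] by auto
    qed
  qed
  moreover have "?B \<inter> insert v ` ?C = {}"
    using assms(2) by (auto simp: independent_sets_def)
  moreover have "inj_on (insert v) ?C"
    using assms(2) by (auto simp: inj_on_def independent_sets_def)
  moreover have "prod w (insert v I) = w v * prod w I" if "I \<in> ?C" for I
    using that assms(2) finite_independent_set[OF X(2) that]
    by (intro prod.insert) (auto simp: independent_sets_def)
  ultimately show ?thesis
    using finite_independent_sets[OF X(1)] finite_independent_sets[OF X(2)]
    by (simp add: Z_def sum.union_disjoint sum.reindex sum_distrib_left)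
qed

lemma Z_mono:
  assumes "\<And>v. v \<in> V \<Longrightarrow> 0 \<le> w v" "X \<subseteq> Y" "Y \<subseteq> V"
  shows "Z w X \<le> Z w Y"
  unfolding Z_def
proof (rule sum_mono2)
  show "finite (independent_sets Y E)" by (rule finite_independent_sets[OF assms(3)])
  show "independent_sets X E \<subseteq> independent_sets Y E"
    using assms(2) by (auto simp: independent_sets_def)
  show "0 \<le> prod w I" if "I \<in> independent_sets Y E - independent_sets X E" for I
    using that assms by (intro prod_nonneg) (auto simp: independent_sets_def)
qed

lemma Z_ge_1:
  assumes "\<And>v. v \<in> V \<Longrightarrow> 0 \<le> w v" "X \<subseteq> V"
  shows "1 \<le> Z w X"
  using Z_mono[OF assms(1) empty_subsetI assms(2)] by simp

text \<open>
  By \<open>Z_insert\<close> and monotonicity, one extra vertex \<open>v\<close> multiplies \<open>Z\<close> by at most \<open>exp (s v)\<close>.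
\<close>

lemma Z_Un_le:
  assumes "\<And>v. v \<in> V \<Longrightarrow> 0 \<le> s v" "A \<subseteq> V" "X \<subseteq> V" "X \<inter> A = {}"
  shows "Z (\<lambda>v. exp (s v) - 1) (X \<union> A) \<le> Z (\<lambda>v. exp (s v) - 1) X * exp (sum s A)"
proof -
  let ?w = "\<lambda>v. exp (s v) - 1"
  have "finite A" using assms(2) finite_V by (rule finite_subset)
  then show ?thesis using assms(2,4)
  proof (induction A)
    case empty
    then show ?case by simp
  next
    case (insert v A)
    have sv: "0 \<le> ?w v" if "v \<in> V" for v using assms(1)[OF that] by simp
    have "Z ?w (X \<union> insert v A) = Z ?w (X \<union> A) + ?w v * Z ?w (X \<union> A - N v)"
      using Z_insert[of v "X \<union> A"] insert.hyps insert.prems assms(3) by simp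
    also have "\<dots> \<le> Z ?w (X \<union> A) + ?w v * Z ?w (X \<union> A)"
      using insert.prems assms(3) sv by (intro add_left_mono mult_left_mono Z_mono) auto
    also have "\<dots> = exp (s v) * Z ?w (X \<union> A)"
      by (simp add: algebra_simps)
    also have "\<dots> \<le> exp (s v) * (Z ?w X * exp (sum s A))"
      using insert.prems by (intro mult_left_mono insert.IH) auto
    also have "\<dots> = Z ?w X * exp (sum s (insert v A))"
      using insert.hyps by (simp add: exp_add algebra_simps)
    finally show ?case .
  qed
qed

text \<open>
  An independent set is determined by its trace \<open>J\<close> on \<open>Y\<close> and its trace on \<open>F\<close>, and the latter is
  an arbitrary independent set of vertices not adjacent to \<open>J\<close>. This is conditioning on the outside
  of \<open>F\<close>.
\<close>

lemma Z_fibre: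
  assumes "Y \<subseteq> V" "F \<subseteq> V" "Y \<inter> F = {}"
  shows "Z w (Y \<union> F) = (\<Sum>J\<in>independent_sets Y E. prod w J * Z w (F - \<Union>(N ` J)))"
proof -
  have sub: "Y \<union> F \<subseteq> V" "\<And>J. F - \<Union>(N ` J) \<subseteq> V" using assms by auto
  let ?S = "Sigma (independent_sets Y E) (\<lambda>J. independent_sets (F - \<Union>(N ` J)) E)"
  have "Z w (Y \<union> F) = (\<Sum>(J, I)\<in>?S. prod w J * prod w I)"
    unfolding Z_def
  proof (rule sum.reindex_bij_witness[of _ "\<lambda>(J, I). J \<union> I" "\<lambda>I. (I \<inter> Y, I \<inter> F)"]; clarsimp?)
    fix I assume "I \<in> independent_sets (Y \<union> F) E"
    then have I: "I \<subseteq> Y \<union> F" "\<forall>u\<in>I. \<forall>v\<in>I. u \<notin> N v"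
      using independent_sets_iff[OF sub(1)] by auto
    show "I \<inter> Y \<union> I \<inter> F = I" using I by auto
    show "I \<inter> Y \<in> independent_sets Y E \<and> I \<inter> F \<in> independent_sets (F - \<Union> (N ` (I \<inter> Y))) E"
      using I independent_sets_iff[OF assms(1)] independent_sets_iff[OF sub(2)] by auto
    have "finite I" using I sub finite_V by (meson finite_subset)
    then have "prod w (I \<inter> Y \<union> I \<inter> F) = prod w (I \<inter> Y) * prod w (I \<inter> F)"
      using assms(3) by (intro prod.union_disjoint) auto
    also have "I \<inter> Y \<union> I \<inter> F = I" by fact
    finally show "prod w (I \<inter> Y) * prod w (I \<inter> F) = prod w I" by simp
  next
    fix J I assume "J \<in> independent_sets Y E" "I \<in> independent_sets (F - \<Union> (N ` J)) E"
    then have J: "J \<subseteq> Y" "\<forall>u\<in>J. \<forall>v\<in>J. u \<notin> N v" "I \<subseteq> F - \<Union> (N ` J)" "\<forall>u\<in>I. \<forall>v\<in>I. u \<notin> N v"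
      using independent_sets_iff[OF assms(1)] independent_sets_iff[OF sub(2)] by auto
    show "(J \<union> I) \<inter> Y = J \<and> (J \<union> I) \<inter> F = I" using J assms(3) by auto
    show "J \<union> I \<in> independent_sets (Y \<union> F) E"
      using J unfolding independent_sets_iff[OF sub(1)] using neighbors_sym by blast
  qed
  also have "\<dots> = (\<Sum>J\<in>independent_sets Y E. \<Sum>I\<in>independent_sets (F - \<Union>(N ` J)) E. prod w J * prod w I)"
    by (subst sum.Sigma) (use finite_independent_sets assms(1) sub in auto)
  also have "\<dots> = (\<Sum>J\<in>independent_sets Y E. prod w J * Z w (F - \<Union>(N ` J)))"
    by (simp add: Z_def sum_distrib_left)
  finally show ?thesis .
qed

text \<open>
  In the logarithmic coordinates \<open>s\<close> the partial derivative at \<open>v\<close> is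
  \<open>exp (s v) * Z (X - N v - {v})\<close>, and this is \<open>Z (X - N v)\<close> because \<open>v\<close> is isolated there.
\<close>

lemma DERIV_Z:
  assumes "\<And>v. v \<in> V \<Longrightarrow> (s v has_real_derivative s' v) (at t)" "X \<subseteq> V"
  defines "w \<equiv> \<lambda>t v. exp (s v t) - 1"
  shows "((\<lambda>t. Z (w t) X) has_real_derivative (\<Sum>v\<in>X. s' v * Z (w t) (X - N v))) (at t)"
proof -
  have "finite X" using assms(2) finite_V by (rule finite_subset)
  then show ?thesis using assms(2)
  proof (induction X rule: finite_psubset_induct)
    case (psubset X)
    show ?case
    proof (cases "X = {}")
      case True
      then show ?thesis by simp
    next
      case False
      then obtain v where "v \<in> X" by blast
      define Y where "Y = X - {v}"
      have Y: "X = insert v Y" "v \<notin> Y" "v \<in> V" "Y \<subseteq> V" "finite Y" "insert v Y \<subseteq> V"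
        using \<open>v \<in> X\<close> psubset by (auto simp: Y_def)
      have "((\<lambda>t. Z (w t) Y + w t v * Z (w t) (Y - N v)) has_real_derivative
          (\<Sum>u\<in>Y. s' u * Z (w t) (Y - N u)) + (w t v * (\<Sum>u\<in>Y - N v. s' u * Z (w t) (Y - N v - N u))
            + s' v * exp (s v t) * Z (w t) (Y - N v))) (at t)"
      proof (intro DERIV_add DERIV_mult')
        show "((\<lambda>t. Z (w t) Y) has_real_derivative (\<Sum>u\<in>Y. s' u * Z (w t) (Y - N u))) (at t)"
          using Y by (intro psubset.IH) auto
        show "((\<lambda>t. Z (w t) (Y - N v)) has_real_derivative
            (\<Sum>u\<in>Y - N v. s' u * Z (w t) (Y - N v - N u))) (at t)"
          using Y by (intro psubset.IH) auto
        show "((\<lambda>t. w t v) has_real_derivative s' v * exp (s v t)) (at t)"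
          unfolding w_def using assms(1)[OF Y(3)] by (auto intro!: derivative_eq_intros)
      qed
      also have "(\<lambda>t. Z (w t) Y + w t v * Z (w t) (Y - N v)) = (\<lambda>t. Z (w t) X)"
        using Z_insert[OF Y(6,2)] Y(1) by simp
      also have "(\<Sum>u\<in>Y. s' u * Z (w t) (Y - N u)) + (w t v * (\<Sum>u\<in>Y - N v. s' u * Z (w t) (Y - N v - N u))
            + s' v * exp (s v t) * Z (w t) (Y - N v)) = (\<Sum>u\<in>X. s' u * Z (w t) (X - N u))"
      proof -
        have "w t v * (\<Sum>u\<in>Y - N v. s' u * Z (w t) (Y - N v - N u))
            = (\<Sum>u\<in>Y. if u \<in> N v then 0 else s' u * (w t v * Z (w t) (Y - N u - N v)))"
          unfolding sum_distrib_left using Y(5)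
          by (intro sum.mono_neutral_cong_left) (auto simp: diff_right_commute mult.left_commute)
        then have "(\<Sum>u\<in>Y. s' u * Z (w t) (Y - N u)) + w t v * (\<Sum>u\<in>Y - N v. s' u * Z (w t) (Y - N v - N u))
            = (\<Sum>u\<in>Y. s' u * Z (w t) (Y - N u) + (if u \<in> N v then 0 else s' u * (w t v * Z (w t) (Y - N u - N v))))"
          by (simp add: sum.distrib)
        also have "\<dots> = (\<Sum>u\<in>Y. s' u * Z (w t) (X - N u))"
        proof (rule sum.cong[OF refl])
          fix u assume u: "u \<in> Y"
          show "s' u * Z (w t) (Y - N u) + (if u \<in> N v then 0 else s' u * (w t v * Z (w t) (Y - N u - N v)))
              = s' u * Z (w t) (X - N u)"
          proof (cases "u \<in> N v")
            case True
            then have "X - N u = Y - N u" using Y(1) neighbors_sym by auto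
            then show ?thesis using True by simp
          next
            case False
            then have "X - N u = insert v (Y - N u)" using Y(1) neighbors_sym by auto
            moreover have "insert v (Y - N u) \<subseteq> V" "v \<notin> Y - N u" using Y by auto
            ultimately show ?thesis
              using False Z_insert[of v "Y - N u" "w t"] by (simp add: algebra_simps)
          qed
        qed
        moreover have "exp (s v t) * Z (w t) (Y - N v) = Z (w t) (X - N v)"
        proof -
          have "X - N v = insert v (Y - N v)" using Y(1) not_own_neighbor by auto
          moreover have "Y - N v - N v = Y - N v" "insert v (Y - N v) \<subseteq> V" "v \<notin> Y - N v"
            using Y by auto
          ultimately show ?thesis
            using Z_insert[of v "Y - N v" "w t"] by (simp add: algebra_simps w_def)
        qed
        ultimately show ?thesis using Y by (simp add: mult.assoc)
      qed
      finally show ?thesis .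
    qed
  qed
qed


section \<open>Locally sparse graphs\<close>

text \<open>
  Passing from vertex subsets to vertex weights: a nonnegative weight is a positive combination of
  indicators of its superlevel sets, and \<open>min\<close> of two values adds up over these sets. The induction
  peels off the lowest level, which removes a vertex of minimal weight.
\<close>

lemma sum_min_adjacent_le:
  fixes s :: "'a \<Rightarrow> real"
  assumes "finite F" "\<And>v. v \<in> F \<Longrightarrow> 0 \<le> s v"
    and "\<And>X. X \<subseteq> F \<Longrightarrow> (\<Sum>u\<in>X. real (card (N u \<inter> X))) \<le> a * real (card X)"
  shows "(\<Sum>u\<in>F. \<Sum>w\<in>N u \<inter> F. min (s u) (s w)) \<le> a * sum s F"
  using assms
proof (induction F arbitrary: s rule: finite_psubset_induct)
  case (psubset F)
  show ?case
  proof (cases "F = {}")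
    case True
    then show ?thesis by simp
  next
    case False
    then obtain x where x: "x \<in> F" "\<And>y. y \<in> F \<Longrightarrow> s x \<le> s y"
      using arg_min_if_finite(1)[OF psubset.hyps] arg_min_least[OF psubset.hyps] by metis
    define r where "r = (\<lambda>v. s v - s x)"
    let ?G = "F - {x}"
    have r: "0 \<le> r v" if "v \<in> F" for v using x that by (simp add: r_def)
    have rx: "r x = 0" by (simp add: r_def)
    have "(\<Sum>u\<in>F. \<Sum>w\<in>N u \<inter> F. min (s u) (s w))
        = (\<Sum>u\<in>F. \<Sum>w\<in>N u \<inter> F. s x + min (r u) (r w))"
      by (intro sum.cong refl) (auto simp: r_def)
    also have "\<dots> = s x * (\<Sum>u\<in>F. real (card (N u \<inter> F))) + (\<Sum>u\<in>F. \<Sum>w\<in>N u \<inter> F. min (r u) (r w))"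
      by (simp add: sum.distrib sum_distrib_left mult.commute)
    also have "(\<Sum>u\<in>F. \<Sum>w\<in>N u \<inter> F. min (r u) (r w)) = (\<Sum>u\<in>?G. \<Sum>w\<in>N u \<inter> ?G. min (r u) (r w))"
    proof -
      have "(\<Sum>w\<in>N u \<inter> F. min (r u) (r w)) = (\<Sum>w\<in>N u \<inter> ?G. min (r u) (r w))" if "u \<in> F" for u
        using r[OF that] psubset.hyps rx by (intro sum.mono_neutral_right) auto
      moreover have "(\<Sum>w\<in>N x \<inter> ?G. min (r x) (r w)) = 0"
        using r rx by (intro sum.neutral) auto
      ultimately show ?thesis
        using psubset.hyps x(1) by (simp add: sum.remove[of F x])
    qed
    also have "s x * (\<Sum>u\<in>F. real (card (N u \<inter> F))) \<le> s x * (a * real (card F))"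
      using psubset.prems x by (intro mult_left_mono) auto
    also have "(\<Sum>u\<in>?G. \<Sum>w\<in>N u \<inter> ?G. min (r u) (r w)) \<le> a * sum r ?G"
      using x(1) r psubset.prems by (intro psubset.IH) auto
    also have "sum r ?G = sum r F"
      using psubset.hyps x(1) rx by (simp add: sum.remove[of F x])
    also have "s x * (a * real (card F)) + a * sum r F = a * sum s F"
      by (simp add: r_def sum_subtractf algebra_simps)
    finally show ?thesis by simp
  qed
qed

text \<open>
  After division by \<open>Z F\<close> this says that a sparse \<open>F\<close> has many uncovered vertices. Indeed
  \<open>ln (Z F) \<le> sum s F\<close>, while a vertex \<open>u\<close> is uncovered with probability at least \<open>exp (- m u)\<close>,
  where \<open>m u\<close> is the weight of its neighbors in \<open>F\<close>; sparsity makes the weighted mean of \<open>m\<close> at most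
  \<open>a * L\<close>, and convexity of \<open>exp\<close> then loses only the factor \<open>exp (a * L)\<close>.
\<close>

lemma Z_ln_Z_le:
  fixes s :: "'a \<Rightarrow> real"
  assumes s: "\<And>v. v \<in> V \<Longrightarrow> 0 \<le> s v \<and> s v \<le> L" and F: "F \<subseteq> V"
    and sparse: "\<And>X. X \<subseteq> F \<Longrightarrow> (\<Sum>u\<in>X. real (card (N u \<inter> X))) \<le> a * real (card X)"
  defines "w \<equiv> \<lambda>v. exp (s v) - 1"
  shows "Z w F * ln (Z w F) \<le> exp (a * L) * (\<Sum>u\<in>F. s u * Z w (F - N u))"
proof -
  have finF: "finite F" using F finite_V by (rule finite_subset)
  have w: "0 \<le> w v" if "v \<in> V" for v using s[OF that] by (simp add: w_def)
  have Z1: "1 \<le> Z w F" using Z_ge_1[OF w F] .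
  have ln_le: "ln (Z w F) \<le> sum s F"
  proof -
    have "Z w F \<le> exp (sum s F)"
      using Z_Un_le[of s F "{}"] s F by (simp add: w_def)
    then show ?thesis using Z1 by (metis ln_mono exp_gt_zero ln_exp less_le_trans zero_less_one)
  qed
  define m where "m u = sum s (N u \<inter> F)" for u
  \<comment> \<open>Since \<open>s \<le> L\<close>, a product \<open>s u * s v\<close> is at most \<open>L * min (s u) (s v)\<close>.\<close>
  have quad: "(\<Sum>u\<in>F. s u * m u) \<le> a * L * sum s F"
  proof (cases "F = {}")
    case False
    then have L: "0 \<le> L" using s F by force
    have "(\<Sum>u\<in>F. s u * m u) = (\<Sum>u\<in>F. \<Sum>v\<in>N u \<inter> F. s u * s v)"
      by (simp add: m_def sum_distrib_left)
    also have "\<dots> \<le> (\<Sum>u\<in>F. \<Sum>v\<in>N u \<inter> F. L * min (s u) (s v))"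
    proof (intro sum_mono)
      fix u v assume "u \<in> F" "v \<in> N u \<inter> F"
      then have "u \<in> V" "v \<in> V" using F by auto
      then have "s u * s v \<le> L * s v" "s v * s u \<le> L * s u"
        using s by (auto intro!: mult_right_mono)
      then show "s u * s v \<le> L * min (s u) (s v)" by (simp add: min_def mult.commute)
    qed
    also have "\<dots> = L * (\<Sum>u\<in>F. \<Sum>v\<in>N u \<inter> F. min (s u) (s v))"
      by (simp add: sum_distrib_left)
    also have "\<dots> \<le> L * (a * sum s F)"
      using L s F by (intro mult_left_mono sum_min_adjacent_le finF sparse) auto
    finally show ?thesis by (simp add: mult_ac)
  qed simp
  have "sum s F \<le> (\<Sum>u\<in>F. s u * (1 + a * L - m u))"
    using quad by (simp add: algebra_simps sum.distrib sum_subtractf sum_distrib_left)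
  also have "\<dots> \<le> (\<Sum>u\<in>F. s u * exp (a * L - m u))"
  proof (intro sum_mono mult_left_mono)
    show "1 + a * L - m u \<le> exp (a * L - m u)" for u
      using exp_ge_add_one_self[of "a * L - m u"] by linarith
  qed (use s F in auto)
  finally have main: "sum s F \<le> (\<Sum>u\<in>F. s u * exp (a * L - m u))" .
  have occ: "Z w F * exp (- m u) \<le> Z w (F - N u)" for u
  proof -
    have "Z w ((F - N u) \<union> (N u \<inter> F)) \<le> Z w (F - N u) * exp (m u)"
      unfolding w_def m_def using s F by (intro Z_Un_le) auto
    moreover have "(F - N u) \<union> (N u \<inter> F) = F" by auto
    ultimately show ?thesis by (simp add: exp_minus field_simps)
  qed
  have "Z w F * ln (Z w F) \<le> Z w F * sum s F"
    using Z1 ln_le by (intro mult_left_mono) auto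
  also have "\<dots> \<le> Z w F * (\<Sum>u\<in>F. s u * exp (a * L - m u))"
    using Z1 main by (intro mult_left_mono) auto
  also have "\<dots> = exp (a * L) * (\<Sum>u\<in>F. s u * (Z w F * exp (- m u)))"
    by (simp add: sum_distrib_left exp_diff exp_minus field_simps)
  also have "\<dots> \<le> exp (a * L) * (\<Sum>u\<in>F. s u * Z w (F - N u))"
    using s F by (intro mult_left_mono sum_mono occ) auto
  finally show ?thesis .
qed

text \<open>
  Divided by \<open>exp b * Z V\<close>, this bounds the probability that \<open>v\<close> is uncovered from below by the
  tangent line at \<open>b\<close> of a convex function. The free parameter \<open>b\<close> is what allows these inequalities
  to be combined linearly later.
\<close>

lemma uncovered_weight_ge:
  fixes s :: "'a \<Rightarrow> real"
  assumes s: "\<And>v. v \<in> V \<Longrightarrow> 0 \<le> s v \<and> s v \<le> L"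
    and sparse: "\<And>X. X \<subseteq> N v \<Longrightarrow> (\<Sum>u\<in>X. real (card (N u \<inter> X))) \<le> a * real (card X)"
  defines "w \<equiv> \<lambda>v. exp (s v) - 1"
  shows "(1 + b) * Z w V - exp (a * L) * (\<Sum>u\<in>N v. s u * Z w (V - N u)) \<le> exp b * Z w (V - N v)"
proof -
  define F where "F = N v"
  define Y where "Y = V - F"
  define FJ where "FJ J = F - \<Union>(N ` J)" for J
  have F: "F \<subseteq> V" "finite F" and Y: "Y \<subseteq> V" "Y \<inter> F = {}" "Y \<union> F = V"
    using neighbors_subset finite_neighbors by (auto simp: F_def Y_def)
  have FJ: "FJ J \<subseteq> V" "FJ J \<subseteq> F" for J using F by (auto simp: FJ_def)
  let ?I = "independent_sets Y E"
  have w: "0 \<le> w v" if "v \<in> V" for v using s[OF that] by (simp add: w_def)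
  have finI: "finite ?I" using finite_independent_sets[OF Y(1)] .
  have wJ: "0 \<le> prod w J" if "J \<in> ?I" for J
    using that w Y by (intro prod_nonneg) (auto simp: independent_sets_def)
  have ZV: "Z w V = (\<Sum>J\<in>?I. prod w J * Z w (FJ J))"
    using Z_fibre[OF Y(1) F(1) Y(2)] Y(3) by (simp add: FJ_def)
  have ZN: "Z w (V - N u) = (\<Sum>J\<in>{J\<in>?I. u \<notin> \<Union>(N ` J)}. prod w J * Z w (FJ J - N u))" for u
  proof -
    have "V - N u = (Y - N u) \<union> (F - N u)" using Y by auto
    then have "Z w (V - N u) = (\<Sum>J\<in>independent_sets (Y - N u) E. prod w J * Z w (F - N u - \<Union>(N ` J)))"
      using Z_fibre[of "Y - N u" "F - N u" w] Y F by auto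
    also have "independent_sets (Y - N u) E = {J\<in>?I. u \<notin> \<Union>(N ` J)}"
      using neighbors_sym by (auto simp: independent_sets_def)
    finally show ?thesis by (simp add: FJ_def diff_right_commute)
  qed
  have "(\<Sum>u\<in>F. s u * Z w (V - N u))
      = (\<Sum>u\<in>F. \<Sum>J\<in>{J\<in>?I. u \<notin> \<Union>(N ` J)}. prod w J * (s u * Z w (FJ J - N u)))"
    unfolding ZN by (simp add: sum_distrib_left mult.left_commute)
  also have "\<dots> = (\<Sum>J\<in>?I. \<Sum>u\<in>{u\<in>F. u \<notin> \<Union>(N ` J)}. prod w J * (s u * Z w (FJ J - N u)))"
    by (rule sum.swap_restrict[OF F(2) finI])
  also have "\<dots> = (\<Sum>J\<in>?I. prod w J * (\<Sum>u\<in>FJ J. s u * Z w (FJ J - N u)))"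
    by (intro sum.cong refl) (auto simp: FJ_def sum_distrib_left intro!: sum.cong)
  finally have ZS: "(\<Sum>u\<in>F. s u * Z w (V - N u)) = (\<Sum>J\<in>?I. prod w J * (\<Sum>u\<in>FJ J. s u * Z w (FJ J - N u)))" .
  \<comment> \<open>The inequality for one fibre: the tangent bound \<open>exp x \<ge> 1 + x\<close> at \<open>x = b - ln (Z (FJ J))\<close>.\<close>
  have fibre: "(1 + b) * Z w (FJ J) - exp (a * L) * (\<Sum>u\<in>FJ J. s u * Z w (FJ J - N u)) \<le> exp b" for J
  proof -
    have Z1: "1 \<le> Z w (FJ J)" using Z_ge_1[OF w FJ(1)] .
    have "Z w (FJ J) * ln (Z w (FJ J)) \<le> exp (a * L) * (\<Sum>u\<in>FJ J. s u * Z w (FJ J - N u))"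
      unfolding w_def using FJ[of J] by (intro Z_ln_Z_le s sparse) (auto simp: F_def)
    moreover have "(1 + b - ln (Z w (FJ J))) * Z w (FJ J) \<le> exp (b - ln (Z w (FJ J))) * Z w (FJ J)"
    proof (rule mult_right_mono)
      show "1 + b - ln (Z w (FJ J)) \<le> exp (b - ln (Z w (FJ J)))"
        using exp_ge_add_one_self[of "b - ln (Z w (FJ J))"] by linarith
    qed (use Z1 in simp)
    moreover have "exp (b - ln (Z w (FJ J))) * Z w (FJ J) = exp b"
      using Z1 by (simp add: exp_diff)
    ultimately show ?thesis by (simp add: algebra_simps)
  qed
  have "(1 + b) * Z w V - exp (a * L) * (\<Sum>u\<in>F. s u * Z w (V - N u))
      = (\<Sum>J\<in>?I. prod w J * ((1 + b) * Z w (FJ J) - exp (a * L) * (\<Sum>u\<in>FJ J. s u * Z w (FJ J - N u))))"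
    unfolding ZV ZS by (simp only: right_diff_distrib sum_subtractf sum_distrib_left mult_ac)
  also have "\<dots> \<le> (\<Sum>J\<in>?I. prod w J * exp b)"
    using wJ fibre by (intro sum_mono mult_left_mono) auto
  also have "\<dots> = exp b * Z w Y" by (simp add: Z_def sum_distrib_left mult.commute)
  finally show ?thesis by (simp add: F_def Y_def)
qed


section \<open>Integration along a path of fugacities\<close>

text \<open>
  The lower bound for \<open>ln Z\<close> collected along the path with parameter \<open>B\<close>; the factor \<open>1/2\<close> is there
  because every edge occurs twice in the double sum.
\<close>

definition path_gain :: "real \<Rightarrow> ('a \<Rightarrow> real) \<Rightarrow> real" where
  "path_gain K B = (\<Sum>v\<in>V. B v) + K / 2 * (\<Sum>v\<in>V. B v * (\<Sum>u\<in>N v. B u))"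

text \<open>
  Along the path \<open>s\<close>, the derivative of \<open>ln Z\<close> is \<open>(\<Sum>v\<in>V. s' v t * p t v) / Z V\<close>, and
  \<open>s'\<close> splits into \<open>B v * exp b\<close> and \<open>K * D v * s v t\<close>. The second part is exactly what the local
  inequalities, weighted by \<open>B\<close>, subtract: exchanging the order of summation over adjacent pairs
  collects the total \<open>K * D u * s u t * p t u\<close> at each vertex \<open>u\<close>.
\<close>

lemma ln_Z_ge_path_gain:
  fixes B :: "'a \<Rightarrow> real" and L :: real
  assumes sparse: "\<And>v X. v \<in> V \<Longrightarrow> X \<subseteq> N v \<Longrightarrow> (\<Sum>u\<in>X. real (card (N u \<inter> X))) \<le> a * real (card X)"
    and B: "\<And>v. v \<in> V \<Longrightarrow> 0 \<le> B v"
  defines "K \<equiv> exp (a * L)"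
  assumes L: "\<And>v. v \<in> V \<Longrightarrow> B v * exp (K * (\<Sum>u\<in>N v. B u)) \<le> L"
  shows "path_gain K B \<le> ln (Z (\<lambda>v. exp (B v * exp (K * (\<Sum>u\<in>N v. B u))) - 1) V)"
proof -
  define D where "D v = (\<Sum>u\<in>N v. B u)" for v
  define s where "s v t = t * B v * exp (t * K * D v)" for v t
  define s' where "s' v t = B v * exp (t * K * D v) * (1 + t * K * D v)" for v t
  define w where "w t v = exp (s v t) - 1" for t v
  define p where "p t v = Z (w t) (V - N v)" for t v
  define gain where "gain t = t * (\<Sum>v\<in>V. B v) + t\<^sup>2 * (K / 2 * (\<Sum>v\<in>V. B v * D v))" for t
  have K: "0 < K" by (simp add: K_def)
  have D: "0 \<le> D v" for v
    unfolding D_def using B neighbors_subset by (intro sum_nonneg) auto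
  have s_bounds: "0 \<le> s v t \<and> s v t \<le> L" if "v \<in> V" "0 \<le> t" "t \<le> 1" for v t
  proof
    show "0 \<le> s v t" using B that by (simp add: s_def)
    have "t * K * D v \<le> 1 * K * D v"
      using that K D by (intro mult_right_mono) auto
    then have "s v t \<le> 1 * B v * exp (K * D v)"
      unfolding s_def using B that by (intro mult_mono) auto
    then show "s v t \<le> L" using L[OF that(1)] by (simp add: D_def)
  qed
  have Z1: "1 \<le> Z (w t) V" if "0 \<le> t" "t \<le> 1" for t
    using s_bounds that by (intro Z_ge_1) (auto simp: w_def)
  have der: "((\<lambda>t. ln (Z (w t) V) - gain t) has_real_derivative
      (\<Sum>v\<in>V. s' v t * p t v) / Z (w t) V - ((\<Sum>v\<in>V. B v) + t * K * (\<Sum>v\<in>V. B v * D v))) (at t)"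
    if t: "0 \<le> t" "t \<le> 1" for t
  proof (rule DERIV_diff)
    have "(s v has_real_derivative s' v t) (at t)" for v
      unfolding s_def s'_def by (auto intro!: derivative_eq_intros simp: algebra_simps)
    then have "((\<lambda>t. Z (w t) V) has_real_derivative (\<Sum>v\<in>V. s' v t * p t v)) (at t)"
      unfolding w_def p_def by (intro DERIV_Z) auto
    from DERIV_chain2[OF DERIV_ln_divide this, unfolded o_def]
    show "((\<lambda>t. ln (Z (w t) V)) has_real_derivative (\<Sum>v\<in>V. s' v t * p t v) / Z (w t) V) (at t)"
      using Z1[OF t] by simp
    show "(gain has_real_derivative ((\<Sum>v\<in>V. B v) + t * K * (\<Sum>v\<in>V. B v * D v))) (at t)"
      unfolding gain_def by (auto intro!: derivative_eq_intros)
  qed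
  have "ln (Z (w 0) V) - gain 0 \<le> ln (Z (w 1) V) - gain 1"
  proof (rule DERIV_nonneg_imp_nondecreasing[where f = "\<lambda>t. ln (Z (w t) V) - gain t"])
    fix t :: real assume t: "0 \<le> t" "t \<le> 1"
    have "(\<Sum>v\<in>V. B v * (1 + t * K * D v)) * Z (w t) V \<le> (\<Sum>v\<in>V. s' v t * p t v)"
    proof -
      have "B v * ((1 + t * K * D v) * Z (w t) V - K * (\<Sum>u\<in>N v. s u t * p t u))
          \<le> B v * (exp (t * K * D v) * p t v)" if v: "v \<in> V" for v
        unfolding p_def w_def K_def using B[OF v] s_bounds t v sparse
        by (intro mult_left_mono uncovered_weight_ge) auto
      then have "(\<Sum>v\<in>V. B v * ((1 + t * K * D v) * Z (w t) V - K * (\<Sum>u\<in>N v. s u t * p t u)))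
          \<le> (\<Sum>v\<in>V. B v * (exp (t * K * D v) * p t v))"
        by (rule sum_mono)
      moreover have "K * (\<Sum>v\<in>V. B v * (\<Sum>u\<in>N v. s u t * p t u)) = K * (\<Sum>u\<in>V. s u t * p t u * D u)"
        unfolding D_def by (subst double_sum_neighbors) (rule refl)
      moreover have "(\<Sum>v\<in>V. s' v t * p t v)
          = (\<Sum>v\<in>V. B v * (exp (t * K * D v) * p t v)) + K * (\<Sum>u\<in>V. s u t * p t u * D u)"
        by (simp add: s'_def s_def sum_distrib_left sum.distrib[symmetric] algebra_simps)
      moreover have "(\<Sum>v\<in>V. B v * ((1 + t * K * D v) * Z (w t) V - K * (\<Sum>u\<in>N v. s u t * p t u)))
          = (\<Sum>v\<in>V. B v * (1 + t * K * D v)) * Z (w t) V - K * (\<Sum>v\<in>V. B v * (\<Sum>u\<in>N v. s u t * p t u))"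
        by (simp only: right_diff_distrib sum_subtractf sum_distrib_right sum_distrib_left mult_ac)
      ultimately show ?thesis by linarith
    qed
    then have "0 \<le> (\<Sum>v\<in>V. s' v t * p t v) / Z (w t) V - (\<Sum>v\<in>V. B v * (1 + t * K * D v))"
      using Z1[OF t] by (simp add: le_divide_eq)
    moreover have "(\<Sum>v\<in>V. B v * (1 + t * K * D v)) = (\<Sum>v\<in>V. B v) + t * K * (\<Sum>v\<in>V. B v * D v)"
      by (simp add: sum.distrib sum_distrib_left algebra_simps)
    ultimately show "\<exists>y. ((\<lambda>t. ln (Z (w t) V) - gain t) has_real_derivative y) (at t) \<and> 0 \<le> y"
      using der[OF t] by auto
  qed simp
  moreover have "0 \<le> ln (Z (w 0) V)" using Z1[of 0] by simp
  moreover have "gain 0 = 0" "gain 1 = path_gain K B" by (simp_all add: gain_def path_gain_def D_def)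
  ultimately have "path_gain K B \<le> ln (Z (w 1) V)" by linarith
  moreover have "w 1 = (\<lambda>v. exp (B v * exp (K * (\<Sum>u\<in>N v. B u))) - 1)"
    by (simp add: fun_eq_iff w_def s_def D_def)
  ultimately show ?thesis by simp
qed


section \<open>The variational problem\<close>

text \<open>
  A Gibbs-type functional: entropy relative to \<open>L\<close> plus an interaction along the edges. Its
  stationarity condition is that the path with parameter \<open>B\<close> ends at the constant \<open>L\<close>.
\<close>

definition free_energy :: "real \<Rightarrow> real \<Rightarrow> ('a \<Rightarrow> real) \<Rightarrow> real" where
  "free_energy K L B = (\<Sum>v\<in>V. B v * ln (B v / L) - B v) + K / 2 * (\<Sum>v\<in>V. B v * (\<Sum>u\<in>N v. B u))"

lemma free_energy_fun_upd:
  assumes "v \<in> V"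
  shows "free_energy K L (B(v := x)) - free_energy K L B
    = (x * ln (x / L) - x) - (B v * ln (B v / L) - B v) + K * (x - B v) * (\<Sum>u\<in>N v. B u)"
proof -
  let ?C = "B(v := x)"
  define D where "D u = (\<Sum>w\<in>N u. B w)" for u
  have CD: "(\<Sum>w\<in>N u. ?C w) = D u + (if u \<in> N v then x - B v else 0)" for u
  proof (cases "u \<in> N v")
    case True
    then have v: "v \<in> N u" using neighbors_sym by blast
    have "(\<Sum>w\<in>N u - {v}. ?C w) = (\<Sum>w\<in>N u - {v}. B w)" by (intro sum.cong) auto
    then show ?thesis
      using True by (simp add: D_def sum.remove[OF finite_neighbors v])
  next
    case False
    then have "v \<notin> N u" using neighbors_sym by blast
    then have "(\<Sum>w\<in>N u. ?C w) = (\<Sum>w\<in>N u. B w)" by (intro sum.cong) auto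
    then show ?thesis using False by (simp add: D_def)
  qed
  have "(\<Sum>u\<in>V - {v}. B u * (if u \<in> N v then x - B v else 0)) = (\<Sum>u\<in>N v. (x - B v) * B u)"
    using finite_V neighbors_subset[of v] not_own_neighbor[of v]
    by (intro sum.mono_neutral_cong_right) auto
  also have "\<dots> = (x - B v) * D v" by (simp add: D_def sum_distrib_left)
  finally have cross: "(\<Sum>u\<in>V - {v}. B u * (if u \<in> N v then x - B v else 0)) = (x - B v) * D v" .
  have "(\<Sum>u\<in>V. ?C u * (\<Sum>w\<in>N u. ?C w)) = x * D v + (\<Sum>u\<in>V - {v}. B u * (D u + (if u \<in> N v then x - B v else 0)))"
    unfolding CD using not_own_neighbor[of v] by (simp add: sum.remove[OF finite_V assms])
  also have "\<dots> = x * D v + (\<Sum>u\<in>V - {v}. B u * D u) + (x - B v) * D v"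
    using cross by (simp add: distrib_left sum.distrib)
  also have "(\<Sum>u\<in>V - {v}. B u * D u) = (\<Sum>u\<in>V. B u * D u) - B v * D v"
    by (simp add: sum.remove[OF finite_V assms])
  finally have quad: "(\<Sum>u\<in>V. ?C u * (\<Sum>w\<in>N u. ?C w)) = (\<Sum>u\<in>V. B u * D u) + 2 * (x - B v) * D v"
    by (simp add: algebra_simps)
  have lin: "(\<Sum>u\<in>V. ?C u * ln (?C u / L) - ?C u)
      = (\<Sum>u\<in>V. B u * ln (B u / L) - B u) + (x * ln (x / L) - x) - (B v * ln (B v / L) - B v)"
    by (simp add: sum.remove[OF finite_V assms])
  show ?thesis unfolding free_energy_def quad lin by (simp add: D_def algebra_simps)
qed

text \<open>
  In one variable the functional is strictly convex, with its unique minimum at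
  \<open>L * exp (- q)\<close>. Hence a point with no larger value is the minimiser itself.
\<close>

lemma entropy_min:
  fixes x q L :: real
  assumes "0 < x" "0 < L"
    and "x * ln (x / L) - x + q * x \<le> y * ln (y / L) - y + q * y" "y = L * exp (- q)"
  shows "x = y"
proof -
  have y: "0 < y" "ln y = ln L - q" using assms by (auto simp: ln_mult)
  have q: "q = ln L - ln y" using y by simp
  have "x * (ln x - ln y) - x \<le> - y"
    using assms(1-3) y(1) unfolding q by (simp add: ln_div algebra_simps)
  then have "1 - y / x \<ge> ln x - ln y"
    using assms(1) by (simp add: field_simps)
  then have "ln (y / x) \<ge> y / x - 1" using assms y by (simp add: ln_div)
  moreover have "ln (y / x) \<le> y / x - 1" using assms y by (intro ln_le_minus_one) auto
  ultimately have "y / x = 1" using assms y by (intro ln_eq_minus_one) auto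
  then show ?thesis using assms(1) by simp
qed

text \<open>
  The box is taken over all elements of the vertex type, in order to use compactness of a full product
  of intervals. A positive lower end \<open>l\<close> keeps the logarithm continuous.
\<close>

lemma free_energy_attains_min:
  assumes "0 < l" "l \<le> L"
  obtains B where "\<And>v. l \<le> B v \<and> B v \<le> L"
    and "\<And>C. (\<And>v. l \<le> C v \<and> C v \<le> L) \<Longrightarrow> free_energy K L B \<le> free_energy K L C"
proof -
  let ?box = "PiE UNIV (\<lambda>_. {l..L}) :: ('a \<Rightarrow> real) set"
  have "compactin (product_topology (\<lambda>_. euclidean) UNIV) ?box"
    by (simp add: compactin_PiE)
  then have "compact ?box"
    by (simp add: euclidean_product_topology)
  moreover have "?box \<noteq> {}" using assms by (auto simp: PiE_eq_empty_iff)
  moreover have "continuous_on ?box (free_energy K L)"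
  proof -
    have c: "continuous_on ?box (\<lambda>B. B v)" for v
      by (rule continuous_on_subset[OF continuous_on_product_coordinates]) auto
    have "B v / L \<noteq> 0" if "B \<in> ?box" for B v
    proof -
      have "l \<le> B v" using that by (auto simp: PiE_iff)
      then show ?thesis using assms by simp
    qed
    then show ?thesis
      unfolding free_energy_def using assms by (intro continuous_intros c) auto
  qed
  ultimately obtain B where "B \<in> ?box" "\<And>C. C \<in> ?box \<Longrightarrow> free_energy K L B \<le> free_energy K L C"
    using continuous_attains_inf[of ?box "free_energy K L"] by blast
  then show ?thesis by (intro that[of B]) (auto simp: PiE_iff)
qed

text \<open>
  Take \<open>B\<close> minimal in a box \<open>{l..L}\<close>. Moving one coordinate to its one-variable optimum stays in the
  box, so minimality forces every coordinate to be at its optimum, which is the first claim, and then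
  \<open>free_energy K L B = - path_gain K B\<close>. The vector \<open>c\<close> lies in the same box, and comparing \<open>B\<close>
  with it gives the second claim.
\<close>

lemma exists_uniform_path_end:
  assumes "0 \<le> K" "0 < L"
    and c: "\<And>v. v \<in> V \<Longrightarrow> 0 < c v \<and> c v * exp (K * real (card (N v)) * c v) = L"
  obtains B where "\<And>v. v \<in> V \<Longrightarrow> 0 < B v \<and> B v * exp (K * (\<Sum>u\<in>N v. B u)) = L"
    and "(\<Sum>v\<in>V. c v + K * real (card (N v)) * (c v)\<^sup>2 / 2) \<le> path_gain K B"
proof -
  \<comment> \<open>Both \<open>(\<Sum>u\<in>N v. B u)\<close> and \<open>card (N v) * c v\<close> are at most \<open>card V * L\<close>, so every one-variable
    optimum, and every \<open>c v\<close>, is at least this \<open>l\<close>.\<close>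
  define l where "l = L * exp (- (K * (real (card V) * L)))"
  have l: "0 < l" "l \<le> L" using assms(1,2) by (auto simp: l_def)
  obtain B where B: "\<And>v. l \<le> B v \<and> B v \<le> L"
    and min: "\<And>C. (\<And>v. l \<le> C v \<and> C v \<le> L) \<Longrightarrow> free_energy K L B \<le> free_energy K L C"
    using free_energy_attains_min[OF l] by metis
  have Bpos: "0 < B v" for v using B[of v] l by linarith
  have box: "l \<le> L * exp (- (K * y)) \<and> L * exp (- (K * y)) \<le> L" if "0 \<le> y" "y \<le> real (card V) * L" for y
    using that assms(1,2) by (auto simp: l_def intro!: mult_left_mono)
  have deg: "real (card (N v)) \<le> real (card V)" for v
    using card_mono[OF finite_V neighbors_subset] by simp
  have critical: "B v = L * exp (- (K * (\<Sum>u\<in>N v. B u)))" if v: "v \<in> V" for v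
  proof -
    define S where "S = (\<Sum>u\<in>N v. B u)"
    define y where "y = L * exp (- (K * S))"
    have "S \<le> real (card (N v)) * L"
      unfolding S_def using sum_bounded_above[of "N v" B L] B by simp
    also have "\<dots> \<le> real (card V) * L" using deg assms(2) by (intro mult_right_mono) auto
    finally have "l \<le> y \<and> y \<le> L"
      unfolding y_def using Bpos by (intro box) (auto simp: S_def less_imp_le intro!: sum_nonneg)
    then have "free_energy K L B \<le> free_energy K L (B(v := y))"
      using B by (intro min) auto
    then have "0 \<le> (y * ln (y / L) - y) - (B v * ln (B v / L) - B v) + K * (y - B v) * S"
      using free_energy_fun_upd[OF v, of K L B y] unfolding S_def by linarith
    moreover have "K * (y - B v) * S = K * S * y - K * S * B v"
      by (simp only: algebra_simps)
    ultimately have "B v * ln (B v / L) - B v + K * S * B v \<le> y * ln (y / L) - y + K * S * y"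
      by linarith
    from entropy_min[OF Bpos assms(2) this y_def] show ?thesis
      by (simp only: y_def S_def)
  qed
  have energy_gain: "free_energy K L B = - path_gain K B"
  proof -
    have "B v * ln (B v / L) = - K * (B v * (\<Sum>u\<in>N v. B u))" if "v \<in> V" for v
    proof -
      have "B v / L = exp (- (K * (\<Sum>u\<in>N v. B u)))"
        using critical[OF that] assms(2) by (simp add: field_simps)
      then show ?thesis by simp
    qed
    then have "(\<Sum>v\<in>V. B v * ln (B v / L) - B v) = (\<Sum>v\<in>V. - K * (B v * (\<Sum>u\<in>N v. B u)) - B v)"
      by (intro sum.cong refl) presburger
    then have "free_energy K L B = (\<Sum>v\<in>V. - K * (B v * (\<Sum>u\<in>N v. B u)) - B v) + K / 2 * (\<Sum>v\<in>V. B v * (\<Sum>u\<in>N v. B u))"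
      unfolding free_energy_def by (rule arg_cong)
    also have "\<dots> = - path_gain K B"
      by (simp only: path_gain_def sum_subtractf sum_distrib_left[symmetric])
    finally show ?thesis .
  qed
  \<comment> \<open>\<open>c\<close> is constrained only on \<open>V\<close>; elsewhere any value in the box will do.\<close>
  define C where "C v = (if v \<in> V then c v else L)" for v
  have cL: "c v = L * exp (- (K * (real (card (N v)) * c v)))" if "v \<in> V" for v
    using c[OF that] by (simp add: exp_minus field_simps)
  have cle: "c v \<le> L" if "v \<in> V" for v
  proof -
    have "c v * 1 \<le> c v * exp (K * real (card (N v)) * c v)"
      using c[OF that] assms(1) by (intro mult_left_mono) auto
    then show ?thesis using c[OF that] by simp
  qed
  have "l \<le> C v \<and> C v \<le> L" for v
  proof (cases "v \<in> V")
    case True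
    have "real (card (N v)) * c v \<le> real (card V) * L"
      using deg cle[OF True] c[OF True] by (intro mult_mono) auto
    then have "l \<le> L * exp (- (K * (real (card (N v)) * c v)))"
      using c[OF True] box[of "real (card (N v)) * c v"] by simp
    then show ?thesis using cL[OF True] cle[OF True] True by (simp add: C_def)
  qed (use l in \<open>simp add: C_def\<close>)
  then have "free_energy K L B \<le> free_energy K L C" by (rule min)
  also have "free_energy K L C = (\<Sum>v\<in>V. c v * ln (c v / L) - c v) + K / 2 * (\<Sum>v\<in>V. c v * (\<Sum>u\<in>N v. c u))"
  proof -
    have "(\<Sum>u\<in>N v. C u) = (\<Sum>u\<in>N v. c u)" for v
      using neighbors_subset[of v] by (intro sum.cong) (auto simp: C_def)
    then show ?thesis by (simp add: free_energy_def C_def)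
  qed
  also have "(\<Sum>v\<in>V. c v * (\<Sum>u\<in>N v. c u)) \<le> (\<Sum>v\<in>V. real (card (N v)) * (c v)\<^sup>2)"
  proof -
    have "(\<Sum>v\<in>V. c v * (\<Sum>u\<in>N v. c u)) = (\<Sum>v\<in>V. \<Sum>u\<in>N v. c v * c u)"
      by (simp add: sum_distrib_left)
    also have "\<dots> \<le> (\<Sum>v\<in>V. \<Sum>u\<in>N v. (c v)\<^sup>2 / 2 + (c u)\<^sup>2 / 2)"
    proof (intro sum_mono)
      show "c v * c u \<le> (c v)\<^sup>2 / 2 + (c u)\<^sup>2 / 2" for u v
        using sum_squares_bound[of "c v" "c u"] by simp
    qed
    also have "\<dots> = (\<Sum>v\<in>V. \<Sum>u\<in>N v. (c v)\<^sup>2 / 2) + (\<Sum>v\<in>V. \<Sum>u\<in>N v. (c u)\<^sup>2 / 2)"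
      by (simp add: sum.distrib)
    also have "(\<Sum>v\<in>V. \<Sum>u\<in>N v. (c u)\<^sup>2 / 2) = (\<Sum>v\<in>V. \<Sum>u\<in>N v. (c v)\<^sup>2 / 2)"
      by (rule sum_neighbors_swap)
    finally show ?thesis by (simp add: sum.distrib[symmetric])
  qed
  also have "(\<Sum>v\<in>V. c v * ln (c v / L) - c v) = (\<Sum>v\<in>V. - K * (real (card (N v)) * (c v)\<^sup>2) - c v)"
  proof (intro sum.cong refl)
    fix v assume v: "v \<in> V"
    have "c v / L = exp (- (K * (real (card (N v)) * c v)))"
      using cL[OF v] assms(2) by (simp add: field_simps)
    then show "c v * ln (c v / L) - c v = - K * (real (card (N v)) * (c v)\<^sup>2) - c v"
      by (simp add: power2_eq_square)
  qed
  also have "(\<Sum>v\<in>V. - K * (real (card (N v)) * (c v)\<^sup>2) - c v)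
      + K / 2 * (\<Sum>v\<in>V. real (card (N v)) * (c v)\<^sup>2)
      = - (\<Sum>v\<in>V. c v + K * real (card (N v)) * (c v)\<^sup>2 / 2)"
    unfolding sum_distrib_left sum.distrib[symmetric] sum_negf[symmetric]
    by (intro sum.cong refl) (simp add: field_simps)
  finally have "(\<Sum>v\<in>V. c v + K * real (card (N v)) * (c v)\<^sup>2 / 2) \<le> path_gain K B"
    using energy_gain assms(1) by (simp add: mult_left_mono)
  moreover have "0 < B v \<and> B v * exp (K * (\<Sum>u\<in>N v. B u)) = L" if "v \<in> V" for v
  proof
    show "B v * exp (K * (\<Sum>u\<in>N v. B u)) = L"
      by (subst critical[OF that]) (simp add: exp_minus)
  qed (rule Bpos)
  ultimately show ?thesis by (intro that[of B]) auto
qed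


section \<open>Maximum average degree and the Lambert function\<close>

text \<open>
  The handshake identity in the subgraph induced by \<open>X\<close>.
\<close>

lemma sum_degrees_eq:
  assumes "X \<subseteq> V"
  shows "(\<Sum>u\<in>X. real (card (N u \<inter> X))) = 2 * real (card (induced_edges E X))"
proof -
  let ?F = "induced_edges E X"
  have finX: "finite X" using assms finite_V by (rule finite_subset)
  have finF: "finite ?F"
    by (rule finite_subset[of _ "Pow X"]) (auto simp: induced_edges_def finX)
  have "card (N u \<inter> X) = card {e \<in> ?F. u \<in> e}" if u: "u \<in> X" for u
  proof (rule bij_betw_same_card[of "\<lambda>w. {w, u}"], rule bij_betwI')
    show "({x, u} = {y, u}) = (x = y)" for x y by (auto simp: doubleton_eq_iff)
    show "{x, u} \<in> {e \<in> ?F. u \<in> e}" if "x \<in> N u \<inter> X" for x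
      using that u by (auto simp: induced_edges_def neighbors_def)
    fix e assume "e \<in> {e \<in> ?F. u \<in> e}"
    then have e: "e \<in> E" "e \<subseteq> X" "u \<in> e" by (auto simp: induced_edges_def)
    then obtain x y where "e = {x, y}" "x \<in> V" "y \<in> V"
      using simple by (auto simp: simple_graph_def)
    with e show "\<exists>x\<in>N u \<inter> X. e = {x, u}"
      by (auto simp: neighbors_def insert_commute)
  qed
  then have "(\<Sum>u\<in>X. real (card (N u \<inter> X))) = (\<Sum>u\<in>X. \<Sum>e\<in>{e \<in> ?F. u \<in> e}. 1)"
    by simp
  also have "\<dots> = (\<Sum>e\<in>?F. \<Sum>u\<in>{u \<in> X. u \<in> e}. 1)"
    by (rule sum.swap_restrict[OF finX finF])
  also have "\<dots> = (\<Sum>e\<in>?F. 2)"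
  proof (intro sum.cong refl)
    fix e assume "e \<in> ?F"
    then have e: "e \<in> E" "e \<subseteq> X" by (auto simp: induced_edges_def)
    then obtain x y where "e = {x, y}" "x \<noteq> y"
      using simple by (auto simp: simple_graph_def)
    moreover have "{u \<in> X. u \<in> e} = e" using e by blast
    ultimately show "(\<Sum>u\<in>{u \<in> X. u \<in> e}. 1 :: real) = 2" by simp
  qed
  finally show ?thesis by simp
qed

lemma simple_graph_induced:
  assumes "X \<subseteq> V"
  shows "simple_graph X (induced_edges E X)"
  using simple assms finite_V
  by (auto simp: simple_graph_def induced_edges_def intro: finite_subset) blast

lemma sum_degrees_le_mad:
  assumes "S \<subseteq> V" "mad S (induced_edges E S) \<le> a" "X \<subseteq> S"
  shows "(\<Sum>u\<in>X. real (card (N u \<inter> X))) \<le> a * real (card X)"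
proof (cases "X = {}")
  case False
  let ?M = "{2 * real (card E') / real (card V') | V' E'. subgraph V' E' S (induced_edges E S) \<and> V' \<noteq> {}}"
  have S: "S \<noteq> {}" "X \<subseteq> V" using False assms by auto
  have "induced_edges E X \<subseteq> induced_edges E S"
    using assms(3) by (auto simp: induced_edges_def)
  then have "subgraph X (induced_edges E X) S (induced_edges E S)"
    using simple_graph_induced[OF S(2)] assms(3) by (simp add: subgraph_def)
  then have "2 * real (card (induced_edges E X)) / real (card X) \<in> ?M"
    using False by blast
  then have "2 * real (card (induced_edges E X)) / real (card X) \<le> Max ?M"
    using mad_set_finite_nonempty(1)[OF simple_graph_induced[OF assms(1)] S(1)] by (intro Max_ge)
  also have "Max ?M \<le> a" using assms(2) S(1) by (simp add: mad_def)
  finally have "2 * real (card (induced_edges E X)) \<le> a * real (card X)"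
    using False S(2) finite_V by (simp add: field_simps card_gt_0_iff finite_subset)
  then show ?thesis using sum_degrees_eq[OF S(2)] by simp
qed simp

end

text \<open>
  With \<open>c = W / (K * d)\<close>, the equation \<open>W * exp W = K * d * ln (1 + lam)\<close> becomes the equation for
  \<open>c\<close> below, and this form also covers \<open>d = 0\<close>, with \<open>c = ln (1 + lam)\<close>.
\<close>

lemma bound_term_closed_form:
  fixes a d lam :: real
  assumes "0 < lam" "0 \<le> d"
  defines "K \<equiv> (1 + lam) powr a"
  obtains c where "0 < c" "c * exp (K * d * c) = ln (1 + lam)"
    "bound_term a lam d = c + K * d * c\<^sup>2 / 2"
proof (cases "d = 0")
  case True
  then show ?thesis
    using assms(1) by (intro that[of "ln (1 + lam)"]) (auto simp: bound_term_def)
next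
  case False
  let ?L = "ln (1 + lam)"
  define W where "W = lambert_W (K * d * ?L)"
  have K: "0 < K * d" using assms False by (simp add: K_def)
  have L: "0 < ?L" using assms by simp
  have W: "0 \<le> W" "W * exp W = K * d * ?L"
    unfolding W_def using K L by (intro lambert_W; simp)+
  have "W \<noteq> 0" using W(2) K L by auto
  show ?thesis
  proof (rule that[of "W / (K * d)"])
    show "0 < W / (K * d)" using W(1) \<open>W \<noteq> 0\<close> K by simp
    show "W / (K * d) * exp (K * d * (W / (K * d))) = ?L"
    proof -
      have "K \<noteq> 0" using K by auto
      then show ?thesis using W(2) False by (simp add: field_simps)
    qed
    have "bound_term a lam d = (W\<^sup>2 / 2 + W) / (K * d)"
      using False by (simp add: bound_term_def A_fun_def W_def K_def)
    also have "\<dots> = W / (K * d) + K * d * (W / (K * d))\<^sup>2 / 2"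
      using K by (simp add: field_simps power2_eq_square)
    finally show "bound_term a lam d = W / (K * d) + K * d * (W / (K * d))\<^sup>2 / 2" .
  qed
qed

theorem theorem5:
  fixes a :: real and V :: "'a set" and E :: "'a set set" and lam :: real
  assumes "a \<ge> 0"
    and "simple_graph V E"
    and "\<And>v. v \<in> V \<Longrightarrow> mad (neighbors V E v) (induced_edges E (neighbors V E v)) \<le> a"
    and "lam > 0"
  shows "ln (indep_poly V E lam) \<ge> (\<Sum>v\<in>V. bound_term a lam (real (vertex_degree V E v)))"
proof -
  interpret finite_graph V E by unfold_locales (rule assms(2))
  define L where "L = ln (1 + lam)"
  define K where "K = exp (a * L)"
  have L: "0 < L" "exp L = 1 + lam" using assms(4) by (auto simp: L_def)
  have K: "K = (1 + lam) powr a" using assms(4) by (simp add: K_def L_def powr_def)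
  have "\<exists>c. 0 < c \<and> c * exp (K * real (card (N v)) * c) = L
      \<and> bound_term a lam (real (card (N v))) = c + K * real (card (N v)) * c\<^sup>2 / 2" for v
    unfolding K L_def using bound_term_closed_form[OF assms(4), of "real (card (N v))" a] by auto
  then obtain c where c: "\<And>v. 0 < c v \<and> c v * exp (K * real (card (N v)) * c v) = L"
    "\<And>v. bound_term a lam (real (card (N v))) = c v + K * real (card (N v)) * (c v)\<^sup>2 / 2"
    by metis
  obtain B where B: "\<And>v. v \<in> V \<Longrightarrow> 0 < B v \<and> B v * exp (K * (\<Sum>u\<in>N v. B u)) = L"
    and gain_ge: "(\<Sum>v\<in>V. c v + K * real (card (N v)) * (c v)\<^sup>2 / 2) \<le> path_gain K B"
    using exists_uniform_path_end[of K L c] c(1) L(1) by (auto simp: K_def)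
  have "(\<Sum>v\<in>V. bound_term a lam (real (vertex_degree V E v))) \<le> path_gain K B"
    using gain_ge by (simp add: vertex_degree_def c(2))
  also have "path_gain K B \<le> ln (Z (\<lambda>v. exp (B v * exp (K * (\<Sum>u\<in>N v. B u))) - 1) V)"
    unfolding K_def
  proof (rule ln_Z_ge_path_gain)
    show "(\<Sum>u\<in>X. real (card (N u \<inter> X))) \<le> a * real (card X)" if "v \<in> V" "X \<subseteq> N v" for v X
      using sum_degrees_le_mad[OF neighbors_subset assms(3)] that by simp
  qed (use B in \<open>auto simp: K_def less_imp_le\<close>)
  also have "Z (\<lambda>v. exp (B v * exp (K * (\<Sum>u\<in>N v. B u))) - 1) V = indep_poly V E lam"
    unfolding Z_def indep_poly_def
  proof (intro sum.cong refl)
    fix I assume "I \<in> independent_sets V E"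
    then have "I \<subseteq> V" by (simp add: independent_sets_def)
    then have "(\<Prod>v\<in>I. exp (B v * exp (K * (\<Sum>u\<in>N v. B u))) - 1) = (\<Prod>v\<in>I. lam)"
      using B L(2) by (intro prod.cong) auto
    then show "(\<Prod>v\<in>I. exp (B v * exp (K * (\<Sum>u\<in>N v. B u))) - 1) = lam ^ card I" by simp
  qed
  finally show ?thesis .
qed

end
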